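(* Let $\mu = m\alpha_1+n\alpha_2+k\alpha_3$, with $m,n,k\in\mathbb{N}$, be a weight of $\mathfrak{sp}_6(\mathbb{C})$. Then the $q$-analog of Kostant's partition function satisfies $$\wp_q(m\alpha_1+n\alpha_2+k\alpha_3)= q^{m+n+k}\sum_{h=0}^{\hat h}\ \sum_{g=0}^{\hat g}\ \sum_{f=0}^{\hat f}\ \sum_{i=0}^{\hat i}\ \sum_{d=0}^{\hat d}\ \sum_{e=0}^{\hat e}\left(\frac1q\right)^{d+e+2f+3g+4h+2i},$$ where $$\hat d=\min\{m-2h-g-f,\ n-2h-2g-f-2i\},$$ $$\hat e=\min\{n-2h-2g-f-2i-d,\ k-h-g-f-i\},$$ $$\hat f=\min\{m-2h-g,\ n-2h-2g,\ k-h-g\},$$ $$\hat g=\min\left\{m-2h,\ \left\lfloor\tfrac{n-2h}{2}\right\rfloor,\ k-h\right\},$$ $$\hat h=\min\left\{\left\lfloor\tfrac m2\right\rfloor,\ \left\lfloor\tfrac n2\right\rfloor,\ k\right\},$$ $$\hat i=\min\left\{\left\lfloor\tfrac{n-2h-2g-f}{2}\right\rfloor,\ k-h-g-f\right\}.$$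
   Context: $\mathbb{N}=\{0,1,2,\ldots\}$. The simple roots of $\mathfrak{sp}_6(\mathbb{C})$ (type $C_3$) are $\alpha_1=\varepsilon_1-\varepsilon_2$, $\alpha_2=\varepsilon_2-\varepsilon_3$, $\alpha_3=2\varepsilon_3$, where $\varepsilon_1,\varepsilon_2,\varepsilon_3$ is the standard basis of $\mathbb{R}^3$. The positive roots are $$\Phi^+=\{\alpha_1,\ \alpha_2,\ \alpha_3,\ \alpha_1+\alpha_2,\ \alpha_2+\alpha_3,\ \alpha_1+\alpha_2+\alpha_3,\ \alpha_1+2\alpha_2+\alpha_3,\ 2\alpha_1+2\alpha_2+\alpha_3,\ 2\alpha_2+\alpha_3\}.$$ For a weight $\xi$, the $q$-analog of Kostant's partition function is the polynomial $\wp_q(\xi)=\sum_{i\ge 0} c_i q^i$, where $c_i$ is the number of ways to write $\xi$ as a sum of exactly $i$ positive roots with repetition allowed and order disregarded, i.e. the number of families $(n_\beta)_{\beta\in\Phi^+}$ of nonnegative integers with $\sum_\beta n_\beta\beta=\xi$ and $\sum_\beta n_\beta=i$. *)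

theory Defs
  imports "HOL-Analysis.Analysis" "HOL-Computational_Algebra.Computational_Algebra"
begin

abbreviation eps :: "3 \<Rightarrow> real ^ 3" where
  "eps j \<equiv> axis j 1"

definition alpha1 :: "real ^ 3" where "alpha1 = eps 1 - eps 2"
definition alpha2 :: "real ^ 3" where "alpha2 = eps 2 - eps 3"
definition alpha3 :: "real ^ 3" where "alpha3 = 2 *\<^sub>R eps 3"

definition pos_roots :: "(real ^ 3) set" where
  "pos_roots =
    {alpha1, alpha2, alpha3,
     alpha1 + alpha2,
     alpha2 + alpha3,
     alpha1 + alpha2 + alpha3,
     alpha1 + 2 *\<^sub>R alpha2 + alpha3,
     2 *\<^sub>R alpha1 + 2 *\<^sub>R alpha2 + alpha3,
     2 *\<^sub>R alpha2 + alpha3}"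

text \<open>A family of multiplicities indexed by the positive roots is encoded as a function on the
  whole space that vanishes off \<^const>\<open>pos_roots\<close>, so that each family is counted exactly once.\<close>

definition root_partitions :: "real ^ 3 \<Rightarrow> nat \<Rightarrow> (real ^ 3 \<Rightarrow> nat) set" where
  "root_partitions \<xi> i =
    {N. (\<forall>\<beta>. \<beta> \<notin> pos_roots \<longrightarrow> N \<beta> = 0) \<and>
        (\<Sum>\<beta>\<in>pos_roots. real (N \<beta>) *\<^sub>R \<beta>) = \<xi> \<and>
        (\<Sum>\<beta>\<in>pos_roots. N \<beta>) = i}"

definition kostant_coeff :: "real ^ 3 \<Rightarrow> nat \<Rightarrow> nat" where
  "kostant_coeff \<xi> i = card (root_partitions \<xi> i)"

text \<open>The sum over all \<open>i\<close> is taken over the support of the coefficient sequence, which is finite;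
  see \<open>finite_root_partitions\<close>, \<open>finite_kostant_support\<close> and \<open>coeff_kostant_poly\<close>.\<close>

definition kostant_poly :: "real ^ 3 \<Rightarrow> int poly" where
  "kostant_poly \<xi> = (\<Sum>i | kostant_coeff \<xi> i \<noteq> 0. monom (int (kostant_coeff \<xi> i)) i)"

lemma finite_pos_roots: "finite pos_roots"
  by (simp add: pos_roots_def)

lemma finite_root_partitions: "finite (root_partitions \<xi> i)"
proof (rule finite_subset)
  show "root_partitions \<xi> i \<subseteq>
    {N. \<forall>\<beta>. (\<beta> \<in> pos_roots \<longrightarrow> N \<beta> \<in> {..i}) \<and> (\<beta> \<notin> pos_roots \<longrightarrow> N \<beta> = 0)}"
    by (auto simp: root_partitions_def finite_pos_roots intro: member_le_sum)
  show "finite {N. \<forall>\<beta>. (\<beta> \<in> pos_roots \<longrightarrow> N \<beta> \<in> {..i}) \<and> (\<beta> \<notin> pos_roots \<longrightarrow> N \<beta> = (0::nat))}"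
    by (rule finite_set_of_finite_funs) (simp_all add: finite_pos_roots)
qed

text \<open>Every positive root pairs with the vector \<open>(3, 2, 1)\<close> to at least 1.\<close>

lemma pos_root_height: "\<beta> \<in> pos_roots \<Longrightarrow> 1 \<le> \<beta> \<bullet> (3 *\<^sub>R eps 1 + 2 *\<^sub>R eps 2 + eps 3)"
  unfolding pos_roots_def alpha1_def alpha2_def alpha3_def
  by (auto simp: inner_simps inner_axis_axis)

lemma root_partitions_bound:
  assumes "N \<in> root_partitions \<xi> i"
  shows "real i \<le> \<xi> \<bullet> (3 *\<^sub>R eps 1 + 2 *\<^sub>R eps 2 + eps 3)"
proof -
  let ?r = "3 *\<^sub>R eps 1 + 2 *\<^sub>R eps 2 + eps 3"
  have "real i = (\<Sum>\<beta>\<in>pos_roots. real (N \<beta>) * 1)"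
    using assms by (auto simp: root_partitions_def)
  also have "\<dots> \<le> (\<Sum>\<beta>\<in>pos_roots. real (N \<beta>) * (\<beta> \<bullet> ?r))"
    by (intro sum_mono mult_left_mono pos_root_height) auto
  also have "\<dots> = (\<Sum>\<beta>\<in>pos_roots. real (N \<beta>) *\<^sub>R \<beta>) \<bullet> ?r"
    by (simp only: inner_sum_left inner_scaleR_left)
  also have "\<dots> = \<xi> \<bullet> ?r"
    using assms by (simp add: root_partitions_def)
  finally show ?thesis .
qed

lemma finite_kostant_support: "finite {i. kostant_coeff \<xi> i \<noteq> 0}"
proof (rule finite_subset)
  let ?b = "\<xi> \<bullet> (3 *\<^sub>R eps 1 + 2 *\<^sub>R eps 2 + eps 3)"
  show "{i. kostant_coeff \<xi> i \<noteq> 0} \<subseteq> {.. nat \<lfloor>?b\<rfloor>}"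
  proof
    fix i assume "i \<in> {i. kostant_coeff \<xi> i \<noteq> 0}"
    then have "root_partitions \<xi> i \<noteq> {}"
      by (auto simp: kostant_coeff_def)
    then have "real i \<le> ?b"
      using root_partitions_bound by blast
    then show "i \<in> {.. nat \<lfloor>?b\<rfloor>}"
      using le_nat_floor by blast
  qed
qed simp

lemma coeff_kostant_poly: "coeff (kostant_poly \<xi>) i = int (kostant_coeff \<xi> i)"
  using finite_kostant_support[of \<xi>] by (simp add: kostant_poly_def coeff_sum)

text \<open>The identity lives in the field of fractions of the polynomial ring over the integers,
  where the indeterminate has the inverse \<open>1 / q\<close>.\<close>

abbreviation q :: "int poly fract" where
  "q \<equiv> to_fract (monom 1 1)"

abbreviation kostant_q :: "real ^ 3 \<Rightarrow> int poly fract" where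
  "kostant_q \<xi> \<equiv> to_fract (kostant_poly \<xi>)"

end

theory Submission imports Defs begin

text \<open>The nine positive roots are pairwise distinct and the simple roots are linearly independent,
  so a partition of \<open>m\<alpha>\<^sub>1 + n\<alpha>\<^sub>2 + k\<alpha>\<^sub>3\<close> is a tuple of nine natural numbers subject to three linear
  equations, one for each simple root. The multiplicity of a simple root occurs
  with coefficient one in its own equation and not at all in the other two. Hence the multiplicities of the six non-simple roots
  determine the partition, and they can be prescribed exactly when the part of the weight they
  use up is at most \<open>m\<close>, \<open>n\<close> and \<open>k\<close> in the respective coordinates. Replacing a non-simple root of
  height \<open>t\<close> by simple ones turns one part into \<open>t\<close> parts; therefore the number of parts is \<open>m + n + k\<close>
  minus the sum of \<open>t - 1\<close> over the non-simple parts, and this sum is the exponent of \<open>1 / q\<close> in the formula.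

  The letters \<open>d, e, f, g, h, i\<close> stand for the multiplicities of \<open>\<alpha>\<^sub>1 + \<alpha>\<^sub>2\<close>, \<open>\<alpha>\<^sub>2 + \<alpha>\<^sub>3\<close>,
  \<open>\<alpha>\<^sub>1 + \<alpha>\<^sub>2 + \<alpha>\<^sub>3\<close>, \<open>\<alpha>\<^sub>1 + 2\<alpha>\<^sub>2 + \<alpha>\<^sub>3\<close>, \<open>2\<alpha>\<^sub>1 + 2\<alpha>\<^sub>2 + \<alpha>\<^sub>3\<close> and \<open>2\<alpha>\<^sub>2 + \<alpha>\<^sub>3\<close>. The bounds of the
  nested sums come from choosing them one at a time, in the order \<open>h, g, f, i, d, e\<close>: a partial choice
  extends to a partition iff it extends by zeros, and each bound says precisely that the next
  multiplicity fits into what is left of the weight.\<close>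

text \<open>Linear independence is what turns an equation between weights into three equations between
  natural numbers.\<close>

lemma simple_roots_independent:
  "x *\<^sub>R alpha1 + y *\<^sub>R alpha2 + z *\<^sub>R alpha3 = x' *\<^sub>R alpha1 + y' *\<^sub>R alpha2 + z' *\<^sub>R alpha3
    \<longleftrightarrow> x = x' \<and> y = y' \<and> z = z'"
  by (auto simp: alpha1_def alpha2_def alpha3_def vec_eq_iff forall_3 axis_def)

text \<open>If two of the nine expressions denoted the same vector, \<^const>\<open>pos_roots\<close> would have fewer
  elements and its sums fewer terms.\<close>

lemma pos_roots_distinct:
  "distinct [alpha1, alpha2, alpha3, alpha1 + alpha2, alpha2 + alpha3, alpha1 + alpha2 + alpha3,
     alpha1 + 2 *\<^sub>R alpha2 + alpha3, 2 *\<^sub>R alpha1 + 2 *\<^sub>R alpha2 + alpha3, 2 *\<^sub>R alpha2 + alpha3]"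
  by (simp add: alpha1_def alpha2_def alpha3_def vec_eq_iff forall_3 axis_def)

lemma sum_pos_roots:
  fixes F :: "real ^ 3 \<Rightarrow> 'a::comm_monoid_add"
  shows "sum F pos_roots =
    F alpha1 + F alpha2 + F alpha3 + F (alpha1 + alpha2) + F (alpha2 + alpha3)
      + F (alpha1 + alpha2 + alpha3) + F (alpha1 + 2 *\<^sub>R alpha2 + alpha3)
      + F (2 *\<^sub>R alpha1 + 2 *\<^sub>R alpha2 + alpha3) + F (2 *\<^sub>R alpha2 + alpha3)"
proof -
  have "pos_roots = set [alpha1, alpha2, alpha3, alpha1 + alpha2, alpha2 + alpha3,
     alpha1 + alpha2 + alpha3, alpha1 + 2 *\<^sub>R alpha2 + alpha3,
     2 *\<^sub>R alpha1 + 2 *\<^sub>R alpha2 + alpha3, 2 *\<^sub>R alpha2 + alpha3]"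
    by (simp add: pos_roots_def)
  then have "sum F pos_roots = sum_list (map F [alpha1, alpha2, alpha3, alpha1 + alpha2,
     alpha2 + alpha3, alpha1 + alpha2 + alpha3, alpha1 + 2 *\<^sub>R alpha2 + alpha3,
     2 *\<^sub>R alpha1 + 2 *\<^sub>R alpha2 + alpha3, 2 *\<^sub>R alpha2 + alpha3])"
    by (simp only: sum_list_distinct_conv_sum_set pos_roots_distinct)
  then show ?thesis
    by (simp add: add.assoc)
qed

lemma root_partitions_iff:
  "N \<in> root_partitions (real m *\<^sub>R alpha1 + real n *\<^sub>R alpha2 + real k *\<^sub>R alpha3) j \<longleftrightarrow>
    (\<forall>\<beta>. \<beta> \<notin> pos_roots \<longrightarrow> N \<beta> = 0) \<and>
    N alpha1 + N (alpha1 + alpha2) + N (alpha1 + alpha2 + alpha3)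
      + N (alpha1 + 2 *\<^sub>R alpha2 + alpha3)
      + 2 * N (2 *\<^sub>R alpha1 + 2 *\<^sub>R alpha2 + alpha3) = m \<and>
    N alpha2 + N (alpha1 + alpha2) + N (alpha2 + alpha3) + N (alpha1 + alpha2 + alpha3)
      + 2 * N (alpha1 + 2 *\<^sub>R alpha2 + alpha3)
      + 2 * N (2 *\<^sub>R alpha1 + 2 *\<^sub>R alpha2 + alpha3) + 2 * N (2 *\<^sub>R alpha2 + alpha3) = n \<and>
    N alpha3 + N (alpha2 + alpha3) + N (alpha1 + alpha2 + alpha3)
      + N (alpha1 + 2 *\<^sub>R alpha2 + alpha3)
      + N (2 *\<^sub>R alpha1 + 2 *\<^sub>R alpha2 + alpha3) + N (2 *\<^sub>R alpha2 + alpha3) = k \<and>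
    sum N pos_roots = j"
  (is "_ \<longleftrightarrow> ?off \<and> ?A = m \<and> ?B = n \<and> ?C = k \<and> _")
proof -
  have "(\<Sum>\<beta>\<in>pos_roots. real (N \<beta>) *\<^sub>R \<beta>) =
      real ?A *\<^sub>R alpha1 + real ?B *\<^sub>R alpha2 + real ?C *\<^sub>R alpha3"
    unfolding sum_pos_roots by (simp add: algebra_simps)
  then show ?thesis
    unfolding root_partitions_def by (auto simp: simple_roots_independent simp del: of_nat_add)
qed

text \<open>The six entries are the multiplicities of the non-simple roots, in the order
  \<open>h, g, f, i, d, e\<close>; the inequalities express that the multiplicities of the simple roots,
  which are then forced, are natural numbers.\<close>

definition nonsimple_multiplicities ::
  "nat \<Rightarrow> nat \<Rightarrow> nat \<Rightarrow> (nat \<times> nat \<times> nat \<times> nat \<times> nat \<times> nat) set" where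
  "nonsimple_multiplicities m n k =
    {(h, g, f, i, d, e). 2*h + g + f + d \<le> m \<and> 2*h + 2*g + f + 2*i + d + e \<le> n
      \<and> h + g + f + i + e \<le> k}"

text \<open>Each entry is weighted by the height of its root minus one.\<close>

fun height_excess :: "nat \<times> nat \<times> nat \<times> nat \<times> nat \<times> nat \<Rightarrow> nat" where
  "height_excess (h, g, f, i, d, e) = d + e + 2*f + 3*g + 4*h + 2*i"

text \<open>The partition with the given multiplicities of the non-simple roots: the simple roots fill up
  what is missing to \<open>m\<alpha>\<^sub>1 + n\<alpha>\<^sub>2 + k\<alpha>\<^sub>3\<close>. The subtractions are genuine, and the family is a
  partition of that weight, only for tuples in \<^const>\<open>nonsimple_multiplicities\<close>.\<close>

fun complete_family ::
  "nat \<Rightarrow> nat \<Rightarrow> nat \<Rightarrow> nat \<times> nat \<times> nat \<times> nat \<times> nat \<times> nat \<Rightarrow> real ^ 3 \<Rightarrow> nat" where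
  "complete_family m n k (h, g, f, i, d, e) = (\<lambda>_. 0)
    (alpha1 := m - (2*h + g + f + d),
     alpha2 := n - (2*h + 2*g + f + 2*i + d + e),
     alpha3 := k - (h + g + f + i + e),
     alpha1 + alpha2 := d,
     alpha2 + alpha3 := e,
     alpha1 + alpha2 + alpha3 := f,
     alpha1 + 2 *\<^sub>R alpha2 + alpha3 := g,
     2 *\<^sub>R alpha1 + 2 *\<^sub>R alpha2 + alpha3 := h,
     2 *\<^sub>R alpha2 + alpha3 := i)"

lemma complete_family_pos_roots:
  "complete_family m n k (h, g, f, i, d, e) alpha1 = m - (2*h + g + f + d)"
  "complete_family m n k (h, g, f, i, d, e) alpha2 = n - (2*h + 2*g + f + 2*i + d + e)"
  "complete_family m n k (h, g, f, i, d, e) alpha3 = k - (h + g + f + i + e)"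
  "complete_family m n k (h, g, f, i, d, e) (alpha1 + alpha2) = d"
  "complete_family m n k (h, g, f, i, d, e) (alpha2 + alpha3) = e"
  "complete_family m n k (h, g, f, i, d, e) (alpha1 + alpha2 + alpha3) = f"
  "complete_family m n k (h, g, f, i, d, e) (alpha1 + 2 *\<^sub>R alpha2 + alpha3) = g"
  "complete_family m n k (h, g, f, i, d, e) (2 *\<^sub>R alpha1 + 2 *\<^sub>R alpha2 + alpha3) = h"
  "complete_family m n k (h, g, f, i, d, e) (2 *\<^sub>R alpha2 + alpha3) = i"
  unfolding complete_family.simps using pos_roots_distinct
  by (simp_all only: distinct.simps list.set insert_iff empty_iff fun_upd_apply simp_thms if_True if_False
      de_Morgan_disj)

lemma complete_family_off_pos_roots:
  "\<beta> \<notin> pos_roots \<Longrightarrow> complete_family m n k t \<beta> = 0"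
  by (cases t) (simp add: pos_roots_def)

lemma height_excess_le:
  "t \<in> nonsimple_multiplicities m n k \<Longrightarrow> height_excess t \<le> m + n + k"
  by (auto simp: nonsimple_multiplicities_def)

text \<open>The inverse forgets the multiplicities of the simple roots. Nothing is lost, because the three
  weight equations recover them; and since the excess counts the parts gained by splitting every
  non-simple root into simple ones, the number of parts is \<open>m + n + k\<close> minus the excess.\<close>

lemma bij_betw_root_partitions:
  "bij_betw (complete_family m n k)
    {t \<in> nonsimple_multiplicities m n k. m + n + k - height_excess t = j}
    (root_partitions (real m *\<^sub>R alpha1 + real n *\<^sub>R alpha2 + real k *\<^sub>R alpha3) j)"
proof (rule bij_betw_byWitness[where f' = "\<lambda>N.
    (N (2 *\<^sub>R alpha1 + 2 *\<^sub>R alpha2 + alpha3), N (alpha1 + 2 *\<^sub>R alpha2 + alpha3),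
     N (alpha1 + alpha2 + alpha3), N (2 *\<^sub>R alpha2 + alpha3), N (alpha1 + alpha2),
     N (alpha2 + alpha3))"], goal_cases)
  case 1
  show ?case
    by (auto simp: complete_family_pos_roots simp del: complete_family.simps)
next
  case 2
  show ?case
  proof
    fix N
    assume N: "N \<in> root_partitions (real m *\<^sub>R alpha1 + real n *\<^sub>R alpha2 + real k *\<^sub>R alpha3) j"
    show "complete_family m n k
      (N (2 *\<^sub>R alpha1 + 2 *\<^sub>R alpha2 + alpha3), N (alpha1 + 2 *\<^sub>R alpha2 + alpha3),
       N (alpha1 + alpha2 + alpha3), N (2 *\<^sub>R alpha2 + alpha3), N (alpha1 + alpha2),
       N (alpha2 + alpha3)) = N" (is "?M = N")
    proof
      fix \<beta>
      have "\<forall>\<beta>\<in>pos_roots. ?M \<beta> = N \<beta>"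
        unfolding pos_roots_def ball_simps complete_family_pos_roots
        by (intro conjI TrueI refl; use N[unfolded root_partitions_iff] in linarith)
      moreover have "N \<beta> = 0" if "\<beta> \<notin> pos_roots"
        using N that unfolding root_partitions_iff by blast
      ultimately show "?M \<beta> = N \<beta>"
        by (metis complete_family_off_pos_roots)
    qed
  qed
next
  case 3
  show ?case
  proof clarify
    fix h g f i d e
    assume "(h, g, f, i, d, e) \<in> nonsimple_multiplicities m n k"
    \<comment> \<open>The slacks \<open>a\<close>, \<open>b\<close>, \<open>c\<close> in the inequalities are the multiplicities of the simple roots.\<close>
    then obtain a b c where "m = 2*h + g + f + d + a" "n = 2*h + 2*g + f + 2*i + d + e + b"
      "k = h + g + f + i + e + c"
      unfolding nonsimple_multiplicities_def by (auto simp: le_iff_add)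
    then show "complete_family m n k (h, g, f, i, d, e) \<in> root_partitions
        (real m *\<^sub>R alpha1 + real n *\<^sub>R alpha2 + real k *\<^sub>R alpha3)
        (m + n + k - height_excess (h, g, f, i, d, e))"
      unfolding root_partitions_iff
      by (simp add: sum_pos_roots complete_family_pos_roots complete_family_off_pos_roots
          del: complete_family.simps)
  qed
next
  case 4
  show ?case
    by (auto simp: root_partitions_iff sum_pos_roots nonsimple_multiplicities_def)
qed

lemma sum_Sigma_iterated:
  "finite A \<Longrightarrow> (\<And>x. x \<in> A \<Longrightarrow> finite (B x)) \<Longrightarrow>
    sum F (Sigma A B) = (\<Sum>x\<in>A. \<Sum>y\<in>B x. F (x, y))"
  by (simp add: sum.Sigma)

text \<open>The bounds are the inequalities solved for one variable at a time, with the variables still to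
  be chosen set to zero. Truncated subtraction is harmless: the bounds on the earlier variables
  guarantee that the differences formed later are genuine.\<close>

lemma nonsimple_multiplicities_Sigma:
  "nonsimple_multiplicities m n k =
    (SIGMA h : {0..Min {m div 2, n div 2, k}}.
     SIGMA g : {0..Min {m - 2*h, (n - 2*h) div 2, k - h}}.
     SIGMA f : {0..Min {m - 2*h - g, n - 2*h - 2*g, k - h - g}}.
     SIGMA i : {0..Min {(n - 2*h - 2*g - f) div 2, k - h - g - f}}.
     SIGMA d : {0..Min {m - 2*h - g - f, n - 2*h - 2*g - f - 2*i}}.
     {0..Min {n - 2*h - 2*g - f - 2*i - d, k - h - g - f - i}})"
  (is "_ = ?S")
proof -
  have mem_bounds: "x \<in> {0..Min {a, b}} \<longleftrightarrow> x \<le> a \<and> x \<le> b"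
    "x \<in> {0..Min {a, b, c}} \<longleftrightarrow> x \<le> a \<and> x \<le> b \<and> x \<le> c" for x a b c :: nat
    by simp_all
  have "(h, g, f, i, d, e) \<in> nonsimple_multiplicities m n k \<longleftrightarrow> (h, g, f, i, d, e) \<in> ?S"
    (is "?t \<in> _ \<longleftrightarrow> _") for h g f i d e
  proof
    assume "?t \<in> nonsimple_multiplicities m n k"
    then have bounds: "2*h + g + f + d \<le> m" "2*h + 2*g + f + 2*i + d + e \<le> n"
        "h + g + f + i + e \<le> k"
      by (simp_all add: nonsimple_multiplicities_def)
    show "?t \<in> ?S"
      unfolding mem_Sigma_iff mem_bounds
      by (intro conjI; use bounds in linarith)
  next
    assume "?t \<in> ?S"
    then have h: "h \<le> m div 2" "h \<le> n div 2" "h \<le> k"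
      and g: "g \<le> m - 2*h" "g \<le> (n - 2*h) div 2" "g \<le> k - h"
      and f: "f \<le> m - 2*h - g" "f \<le> n - 2*h - 2*g" "f \<le> k - h - g"
      and i: "i \<le> (n - 2*h - 2*g - f) div 2" "i \<le> k - h - g - f"
      and d: "d \<le> m - 2*h - g - f" "d \<le> n - 2*h - 2*g - f - 2*i"
      and e: "e \<le> n - 2*h - 2*g - f - 2*i - d" "e \<le> k - h - g - f - i"
      unfolding mem_Sigma_iff mem_bounds by blast+
    \<comment> \<open>Outermost variable first, since the bound on each variable undoes the subtractions in the
      bounds on the next.\<close>
    have h': "2*h \<le> m" "2*h \<le> n" "h \<le> k"
      using h by linarith+
    have g': "2*h + g \<le> m" "2*h + 2*g \<le> n" "h + g \<le> k"
      using g h' by linarith+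
    have f': "2*h + g + f \<le> m" "2*h + 2*g + f \<le> n" "h + g + f \<le> k"
      using f g' by linarith+
    have i': "2*h + 2*g + f + 2*i \<le> n" "h + g + f + i \<le> k"
      using i f' by linarith+
    have d': "2*h + g + f + d \<le> m"
      using d(1) f'(1) by linarith
    have "2*h + 2*g + f + 2*i + d \<le> n"
      using d(2) i'(1) by linarith
    with e(1) have "2*h + 2*g + f + 2*i + d + e \<le> n"
      by linarith
    moreover have "h + g + f + i + e \<le> k"
      using e(2) i'(2) by linarith
    ultimately show "?t \<in> nonsimple_multiplicities m n k"
      using d' by (simp add: nonsimple_multiplicities_def)
  qed
  then show ?thesis
    by (auto simp only: set_eq_iff split_paired_All)
qed

lemma finite_nonsimple_multiplicities: "finite (nonsimple_multiplicities m n k)"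
  unfolding nonsimple_multiplicities_Sigma by (intro finite_SigmaI finite_atLeastAtMost)

text \<open>The coefficient of \<open>q\<^sup>j\<close> on the right counts the tuples whose partition has \<open>j\<close> parts.\<close>

lemma kostant_poly_eq_sum:
  "kostant_poly (real m *\<^sub>R alpha1 + real n *\<^sub>R alpha2 + real k *\<^sub>R alpha3) =
    (\<Sum>t\<in>nonsimple_multiplicities m n k. monom 1 (m + n + k - height_excess t))"
proof (rule poly_eqI)
  fix j
  have "coeff (\<Sum>t\<in>nonsimple_multiplicities m n k.
      monom (1::int) (m + n + k - height_excess t)) j
    = int (card {t \<in> nonsimple_multiplicities m n k. m + n + k - height_excess t = j})"
    by (simp add: coeff_sum finite_nonsimple_multiplicities sum.If_cases Int_def)
  also have "\<dots> = int (kostant_coeff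
      (real m *\<^sub>R alpha1 + real n *\<^sub>R alpha2 + real k *\<^sub>R alpha3) j)"
    by (simp add: kostant_coeff_def bij_betw_same_card[OF bij_betw_root_partitions])
  finally show "coeff (kostant_poly (real m *\<^sub>R alpha1 + real n *\<^sub>R alpha2 + real k *\<^sub>R alpha3)) j =
    coeff (\<Sum>t\<in>nonsimple_multiplicities m n k. monom 1 (m + n + k - height_excess t)) j"
    by (simp add: coeff_kostant_poly)
qed

lemma to_fract_monom: "to_fract (monom 1 j) = q ^ j"
proof (induction j)
  case (Suc j)
  have "to_fract (monom 1 (Suc j)) = to_fract (monom 1 1 * monom (1::int) j)"
    by (simp only: mult_monom mult_1 plus_1_eq_Suc)
  with Suc show ?case
    by (simp only: to_fract_mult power_Suc)
qed simp

lemma q_nonzero: "q \<noteq> 0"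
  by simp

theorem theorem1p1:
  fixes m n k :: nat
  shows "kostant_q (real m *\<^sub>R alpha1 + real n *\<^sub>R alpha2 + real k *\<^sub>R alpha3) =
    q ^ (m + n + k) *
    (\<Sum>h = 0..Min {m div 2, n div 2, k}.
     \<Sum>g = 0..Min {m - 2*h, (n - 2*h) div 2, k - h}.
     \<Sum>f = 0..Min {m - 2*h - g, n - 2*h - 2*g, k - h - g}.
     \<Sum>i = 0..Min {(n - 2*h - 2*g - f) div 2, k - h - g - f}.
     \<Sum>d = 0..Min {m - 2*h - g - f, n - 2*h - 2*g - f - 2*i}.
     \<Sum>e = 0..Min {n - 2*h - 2*g - f - 2*i - d, k - h - g - f - i}.
       (1 / q) ^ (d + e + 2*f + 3*g + 4*h + 2*i))"
proof -
  have "kostant_q (real m *\<^sub>R alpha1 + real n *\<^sub>R alpha2 + real k *\<^sub>R alpha3) =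
      (\<Sum>t\<in>nonsimple_multiplicities m n k. q ^ (m + n + k - height_excess t))"
    unfolding kostant_poly_eq_sum to_fract_sum by (intro sum.cong refl to_fract_monom)
  also have "\<dots> = (\<Sum>t\<in>nonsimple_multiplicities m n k.
      q ^ (m + n + k) * (1 / q) ^ height_excess t)"
  proof (rule sum.cong)
    \<comment> \<open>The exponent is a truncated difference; the excess never exceeds \<open>m + n + k\<close>.\<close>
    fix t assume "t \<in> nonsimple_multiplicities m n k"
    then show "q ^ (m + n + k - height_excess t) = q ^ (m + n + k) * (1 / q) ^ height_excess t"
      using power_diff[OF q_nonzero height_excess_le] by (simp add: power_one_over)
  qed simp
  also have "\<dots> = q ^ (m + n + k) *
      (\<Sum>t\<in>nonsimple_multiplicities m n k. (1 / q) ^ height_excess t)"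
    by (rule sum_distrib_left[symmetric])
  finally show ?thesis
    unfolding nonsimple_multiplicities_Sigma
    by (simp only: sum_Sigma_iterated finite_SigmaI finite_atLeastAtMost height_excess.simps)
qed

end
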